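(* Let $p,q,r,s,t$ be real algebraic numbers with $0<q<1$ and $|t|<1$ such that $$\frac{p}{\pi}=\sum_{k=0}^{\infty}u_k,\qquad u_k=\frac{\left(\frac{1}{2}\right)_k (q)_k (1-q)_k}{(k!)^3}(r+s\,k)\,t^k,$$ and let $\mathcal{R}_n=\frac{p}{\pi}-\sum_{k=0}^{n}u_k=\sum_{k=n+1}^\infty u_k$. Define $$d_l=\begin{cases} t & (l=0)\\ -\tfrac{1}{2}t & (l=1)\\ q(1-q)t & (l=2)\\ \tfrac{q(1-q)}{2}t & (l\geq 3)\end{cases}$$ and define $(c_j)_{j\in\mathbb{N}_0}$ recursively by $$c_0=\frac{d_0 s}{1-d_0},\qquad c_1=\frac{d_1(s+c_0)+d_0 r}{1-d_0},$$ $$c_N=\frac{d_N(s+c_0)+d_{N-1}r+\sum_{k=1}^{N-1}c_k\left(d_{N-k}-\binom{N-1}{k-1}\right)}{1-d_0}\qquad (N\geq 2).$$ Then for every integer $J\geq 1$, $$\mathcal{R}_n=\frac{\left(\frac{1}{2}\right)_n (q)_n (1-q)_n}{(n!)^3}\,n\,t^n\left(\sum_{j=0}^{J-1}\frac{c_j}{n^j}+\mathcal{O}\left(n^{-J}\right)\right)\qquad (n\to\infty).$$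
   Context: $(a)_k$ denotes the Pochhammer symbol (rising factorial): $(a)_0=1$ and $(a)_k=a(a+1)\cdots(a+k-1)=\Gamma(a+k)/\Gamma(a)$ for $k\geq 1$. $\mathbb{N}_0$ denotes the nonnegative integers. *)

theory Defs
  imports
    "HOL-Analysis.Analysis"
    "HOL-Computational_Algebra.Polynomial"
    "HOL-Library.Landau_Symbols"
begin

definition hyp_coeff :: "real \<Rightarrow> nat \<Rightarrow> real" where
  "hyp_coeff q k = pochhammer (1 / 2) k * pochhammer q k * pochhammer (1 - q) k / fact k ^ 3"

definition series_term :: "real \<Rightarrow> real \<Rightarrow> real \<Rightarrow> real \<Rightarrow> nat \<Rightarrow> real" where
  "series_term q r s t k = hyp_coeff q k * (r + s * real k) * t ^ k"

definition remainder :: "real \<Rightarrow> real \<Rightarrow> real \<Rightarrow> real \<Rightarrow> real \<Rightarrow> nat \<Rightarrow> real" where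
  "remainder p q r s t n = p / pi - (\<Sum>k\<le>n. series_term q r s t k)"

lemma remainder_eq_tail:
  assumes "series_term q r s t sums (p / pi)"
  shows "(\<lambda>k. series_term q r s t (k + Suc n)) sums remainder p q r s t n"
  using sums_split_initial_segment[OF assms, of "Suc n"]
  by (simp add: remainder_def lessThan_Suc_atMost)

(* With b k = hyp_coeff q k * t ^ k, the expansion behind d_coeff is
   b (n + 1) * (n + 1) / (b n * n) = (\<Sum>l. d_coeff q t l / (n + 1) ^ l)
   for n \<ge> 1 and t \<noteq> 0: powers of 1 / (n + 1), not of 1 / n. *)
definition d_coeff :: "real \<Rightarrow> real \<Rightarrow> nat \<Rightarrow> real" where
  "d_coeff q t l =
     (if l = 0 then t
      else if l = 1 then - (1 / 2) * t
      else if l = 2 then q * (1 - q) * t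
      else q * (1 - q) / 2 * t)"

function c_coeff :: "real \<Rightarrow> real \<Rightarrow> real \<Rightarrow> real \<Rightarrow> nat \<Rightarrow> real" where
  "c_coeff q r s t N =
     (if N = 0 then d_coeff q t 0 * s / (1 - d_coeff q t 0)
      else if N = 1 then
        (d_coeff q t 1 * (s + c_coeff q r s t 0) + d_coeff q t 0 * r) / (1 - d_coeff q t 0)
      else
        (d_coeff q t N * (s + c_coeff q r s t 0) + d_coeff q t (N - 1) * r
          + (\<Sum>k = 1..N - 1. c_coeff q r s t k
                * (d_coeff q t (N - k) - real ((N - 1) choose (k - 1)))))
        / (1 - d_coeff q t 0))"
  by auto
termination
  by (relation "Wellfounded.measure (\<lambda>(q, r, s, t, N). N)") auto

(* The unconditional recursion equation would make the simplifier loop. *)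
declare c_coeff.simps [simp del]

end

theory Submission imports Defs
begin

text \<open>
  Put \<open>b n = hyp_coeff q n * n * t ^ n\<close> and \<open>x = 1 / (n + 1)\<close>. Then \<open>b (n + 1) = D x * b n\<close> with
  \<open>D x = (\<Sum>l. d_coeff q t l * x ^ l)\<close> rational, and \<open>1 / n = x / (1 - x)\<close>. The recursion for
  \<open>c_coeff\<close> says precisely that \<open>C y = (\<Sum>j<J. c_coeff q r s t j * y ^ j)\<close> satisfies
  \<open>D x * (s + r * x + C x) - C (x / (1 - x)) = O(x ^ J)\<close>. So the error
  \<open>V n = remainder p q r s t n - b n * C (1 / n)\<close> has increments of size \<open>\<bar>b n\<bar> * O(n powr - J)\<close>;
  as \<open>V\<close> tends to 0 and \<open>b\<close> decays geometrically with ratio tending to \<open>t\<close>, summing the increments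
  gives \<open>\<bar>V n\<bar> \<le> \<bar>b n\<bar> * O(n powr - J)\<close>.
\<close>

section \<open>Power series: the substitution x / (1 - x), the ratio series and the
  recursion\<close>

text \<open>The coefficient of \<open>x ^ n\<close> in \<open>(x / (1 - x)) ^ k\<close>.\<close>

definition shift_coeff :: "nat \<Rightarrow> nat \<Rightarrow> nat" where
  "shift_coeff k n =
     (if k = 0 then (if n = 0 then 1 else 0) else if n = 0 then 0 else (n - 1) choose (k - 1))"

lemma shift_coeff_eq_0: "n < k \<Longrightarrow> shift_coeff k n = 0"
  by (auto simp: shift_coeff_def)

lemma inverse_one_minus_fps_X: "inverse (1 - fps_X :: real fps) * (1 - fps_X) = 1"
  by (rule inverse_mult_eq_1) simp

text \<open>Induction on \<open>k\<close>: multiplying the series for \<open>Suc k\<close> by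
  \<open>1 - fps_X\<close> takes differences of neighbouring coefficients, which Pascal's rule
  evaluates.\<close>

lemma fps_X_div_one_minus_power:
  "(fps_X * inverse (1 - fps_X :: real fps)) ^ k = Abs_fps (\<lambda>n. real (shift_coeff k n))"
proof (induction k)
  case 0
  show ?case by (rule fps_ext) (simp add: shift_coeff_def)
next
  case (Suc k)
  let ?G = "\<lambda>k. Abs_fps (\<lambda>n. real (shift_coeff k n))"
  have "(1 - fps_X) * ?G (Suc k) = fps_X * ?G k"
  proof (rule fps_ext)
    fix n
    have "real (shift_coeff (Suc k) n) - (if n = 0 then 0 else real (shift_coeff (Suc k) (n - 1)))
        = (if n = 0 then 0 else real (shift_coeff k (n - 1)))"
    proof (cases n)
      case 0
      then show ?thesis by (simp add: shift_coeff_def)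
    next
      case (Suc m)
      then show ?thesis
        by (cases m; cases k) (auto simp: shift_coeff_def)
    qed
    then show "fps_nth ((1 - fps_X) * ?G (Suc k)) n = fps_nth (fps_X * ?G k) n"
      by (simp add: algebra_simps)
  qed
  then have "inverse (1 - fps_X) * ((1 - fps_X) * ?G (Suc k)) = inverse (1 - fps_X) * (fps_X * ?G k)"
    by simp
  then have "?G (Suc k) = fps_X * inverse (1 - fps_X) * ?G k"
    by (simp only: mult.assoc[symmetric] inverse_one_minus_fps_X mult_1_left)
      (simp only: mult.commute[of fps_X])
  then show ?case by (simp add: Suc.IH)
qed

text \<open>Since \<open>d_coeff q t\<close> is constant from index 3 on, multiplying its series by
  \<open>1 - fps_X\<close> leaves a cubic polynomial, which factors. The product form is the one
  that \<open>ratio_fun\<close> copies.\<close>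

lemma Abs_fps_d_coeff:
  "Abs_fps (d_coeff q t) =
     fps_const t * (1 - fps_const (1/2) * fps_X) *
       (1 + fps_const (q * (1 - q)) * fps_X * (fps_X * inverse (1 - fps_X)))"
proof -
  have "(1 - fps_X) * Abs_fps (d_coeff q t) =
      fps_const t * (1 - fps_const (1/2) * fps_X) *
        (1 - fps_X + fps_const (q * (1 - q)) * fps_X * fps_X)"
  proof (rule fps_ext)
    fix n :: nat
    have "n = 0 \<or> n = 1 \<or> n = 2 \<or> n = 3 \<or> (\<exists>m. n = m + 4)" by presburger
    then consider "n = 0" | "n = 1" | "n = 2" | "n = 3" | m where "n = m + 4" by blast
    then show "fps_nth ((1 - fps_X) * Abs_fps (d_coeff q t)) n = fps_nth (fps_const t * (1 - fps_const (1/2) * fps_X) *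
        (1 - fps_X + fps_const (q * (1 - q)) * fps_X * fps_X)) n"
      by cases (simp_all add: d_coeff_def algebra_simps fps_X_mult_right_nth)
  qed
  then have "inverse (1 - fps_X) * ((1 - fps_X) * Abs_fps (d_coeff q t)) =
      inverse (1 - fps_X) * (fps_const t * (1 - fps_const (1/2) * fps_X) *
        (1 - fps_X + fps_const (q * (1 - q)) * fps_X * fps_X))"
    by (rule arg_cong)
  then have "Abs_fps (d_coeff q t) = inverse (1 - fps_X) * (fps_const t * (1 - fps_const (1/2) * fps_X) *
        (1 - fps_X + fps_const (q * (1 - q)) * fps_X * fps_X))"
    by (simp only: mult.assoc[symmetric] inverse_one_minus_fps_X mult_1_left)
  also have "\<dots> = fps_const t * (1 - fps_const (1/2) * fps_X) *
       (inverse (1 - fps_X) * (1 - fps_X) + fps_const (q * (1 - q)) * fps_X * (fps_X * inverse (1 - fps_X)))"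
    by (simp only: ring_distribs mult_ac)
  finally show ?thesis by (simp only: inverse_one_minus_fps_X)
qed

text \<open>Both sides are coefficients of x ^ N, in D x * (s + r * x + C x) and in C (x / (1 - x)).
  The term k = N occurs on the left with factor t and on the right with factor 1; collecting the two
  gives the denominator 1 - t of the recursion.\<close>

lemma c_coeff_recurrence:
  assumes "t \<noteq> 1"
  shows "d_coeff q t N * s + (if N = 0 then 0 else d_coeff q t (N - 1) * r)
           + (\<Sum>k\<le>N. c_coeff q r s t k * d_coeff q t (N - k))
       = (\<Sum>k\<le>N. c_coeff q r s t k * real (shift_coeff k N))"
proof -
  let ?c = "c_coeff q r s t" and ?d = "d_coeff q t"
  have d0: "?d 0 = t" by (simp add: d_coeff_def)
  consider "N = 0" | "N = 1" | "N \<ge> 2" by linarith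
  then show ?thesis
  proof cases
    case 1
    have "?c 0 * (1 - t) = t * s"
      using assms by (subst c_coeff.simps) (simp add: d0)
    then show ?thesis using 1 by (simp add: d0 shift_coeff_def algebra_simps)
  next
    case 2
    have "?c 1 * (1 - t) = ?d 1 * (s + ?c 0) + t * r"
      using assms by (subst c_coeff.simps) (simp add: d0)
    then show ?thesis using 2 by (simp add: d0 shift_coeff_def algebra_simps)
  next
    \<comment> \<open>The end terms are split off: k = 0 contributes nothing on the right, and k = N
      is the unknown being solved for.\<close>
    case 3
    have split: "(\<Sum>k\<le>N. f k) = f 0 + (\<Sum>k=1..N-1. f k) + f N" for f :: "nat \<Rightarrow> real"
    proof -
      obtain m where m: "N = Suc m" using 3 by (cases N) auto
      show ?thesis unfolding m
        by (simp add: atMost_atLeast0 sum.atLeast_Suc_atMost[of 0 m])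
    qed
    have c: "?c N * (1 - t) = ?d N * (s + ?c 0) + ?d (N - 1) * r
          + (\<Sum>k = 1..N - 1. ?c k * (?d (N - k) - real ((N - 1) choose (k - 1))))"
      using assms 3 by (subst c_coeff.simps) (simp add: d0)
    have sh: "(\<Sum>k = 1..N - 1. ?c k * real (shift_coeff k N)) =
        (\<Sum>k = 1..N - 1. ?c k * real ((N - 1) choose (k - 1)))"
      using 3 by (intro sum.cong) (auto simp: shift_coeff_def)
    show ?thesis
      using c 3 unfolding split sh
      by (simp add: d0 shift_coeff_def algebra_simps sum_subtractf)
  qed
qed

section \<open>From vanishing coefficients to bounds near 0\<close>

text \<open>Dividing by x ^ n shifts the series, so the quotient has a finite limit at 0. The zero
  series is separate because its \<open>subdegree\<close> is 0 by convention.\<close>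

lemma has_fps_expansion_bigo:
  fixes F :: "real fps"
  assumes "f has_fps_expansion F" "\<And>i. i < n \<Longrightarrow> fps_nth F i = 0"
  shows "f \<in> O[at 0](\<lambda>x. x ^ n)"
proof (cases "F = 0")
  case True
  then have "eventually (\<lambda>x. f x = 0) (at 0)"
    using assms(1) by (auto simp: has_fps_expansion_def eventually_at_filter elim: eventually_mono)
  then show ?thesis by (intro bigoI[of _ 0]) (auto elim: eventually_mono)
next
  case False
  then have "n \<le> subdegree F" using assms(2) by (intro subdegree_geI) auto
  from has_fps_expansion_imp_continuous[OF has_fps_expansion_shift[OF assms(1) this refl], of UNIV]
  have "((\<lambda>x. if x = 0 then fps_nth F n else f x / x ^ n) \<longlongrightarrow> fps_nth F n) (at 0)"
    by (simp add: continuous_within)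
  then have "((\<lambda>x. f x / x ^ n) \<longlongrightarrow> fps_nth F n) (at 0)"
    by (rule Lim_transform_eventually) (auto simp: eventually_at_filter)
  then show ?thesis
    by (rule bigoI_tendsto)
      (rule eventually_mono[OF eventually_neq_at_within[of 0]], simp)
qed

text \<open>The closed form of D from \<open>Abs_fps_d_coeff\<close>, factor by factor, so that its
  expansion can be read off structurally.\<close>

definition ratio_fun :: "real \<Rightarrow> real \<Rightarrow> real \<Rightarrow> real" where
  "ratio_fun q t x = t * (1 - 1/2 * x) * (1 + q * (1 - q) * x * (x * inverse (1 - x)))"

text \<open>Truncating C at J does not affect coefficients below J, because (x / (1 - x)) ^ k starts
  at x ^ k; there the two sides agree by \<open>c_coeff_recurrence\<close>.\<close>

lemma defect_bigo:
  assumes "t \<noteq> 1"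
  shows "(\<lambda>x. ratio_fun q t x * (s + r * x + (\<Sum>j<J. c_coeff q r s t j * x ^ j))
             - (\<Sum>j<J. c_coeff q r s t j * (x * inverse (1 - x)) ^ j)) \<in> O[at 0](\<lambda>x. x ^ J)"
proof (rule has_fps_expansion_bigo)
  let ?c = "c_coeff q r s t" and ?d = "d_coeff q t"
  let ?Y = "fps_X * inverse (1 - fps_X) :: real fps"
  let ?P = "fps_const s + fps_const r * fps_X + (\<Sum>j<J. fps_const (?c j) * fps_X ^ j)"
  let ?D = "fps_const t * (1 - fps_const (1/2) * fps_X) * (1 + fps_const (q * (1 - q)) * fps_X * ?Y)"
  let ?F = "?D * ?P - (\<Sum>j<J. fps_const (?c j) * ?Y ^ j)"
  have Y: "(\<lambda>x. x * inverse (1 - x)) has_fps_expansion ?Y"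
    by (intro fps_expansion_intros) simp
  have Yj: "(\<lambda>x. (x * inverse (1 - x)) ^ j) has_fps_expansion ?Y ^ j" for j
  proof (induction j)
    case (Suc j)
    from has_fps_expansion_mult[OF Y this] show ?case by simp
  qed simp
  have Xj: "(\<lambda>x::real. x ^ j) has_fps_expansion fps_X ^ j" for j
    by (intro fps_expansion_intros)
  show "(\<lambda>x. ratio_fun q t x * (s + r * x + (\<Sum>j<J. c_coeff q r s t j * x ^ j))
             - (\<Sum>j<J. c_coeff q r s t j * (x * inverse (1 - x)) ^ j)) has_fps_expansion ?F"
    unfolding ratio_fun_def by (intro fps_expansion_intros Y Yj Xj)
  fix N assume N: "N < J"
  have [simp]: "fps_nth (\<Sum>j<J. fps_const (?c j) * fps_X ^ j) i = ?c i" if "i \<le> N" for i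
    using that N by (simp add: fps_sum_nth if_distrib cong: if_cong)
  have "fps_nth (?D * ?P) N = (\<Sum>i\<le>N. fps_nth ?P i * ?d (N - i))"
    unfolding Abs_fps_d_coeff[symmetric] 
    by (subst mult.commute) (simp add: fps_mult_nth atMost_atLeast0)
  also have "\<dots> = (\<Sum>i\<le>N. (if i = 0 then ?d N * s else 0) + (if i = 1 then ?d (N - 1) * r else 0) + ?c i * ?d (N - i))"
    by (intro sum.cong refl) (auto simp: distrib_right)
  also have "\<dots> = ?d N * s + (if N = 0 then 0 else ?d (N - 1) * r) + (\<Sum>i\<le>N. ?c i * ?d (N - i))"
    by (simp add: sum.distrib)
  also have "\<dots> = (\<Sum>k\<le>N. ?c k * real (shift_coeff k N))"
    by (rule c_coeff_recurrence[OF assms])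
  also have "\<dots> = (\<Sum>k<J. ?c k * real (shift_coeff k N))"
    using N by (intro sum.mono_neutral_left) (auto simp: shift_coeff_eq_0)
  also have "\<dots> = fps_nth (\<Sum>j<J. fps_const (?c j) * ?Y ^ j) N"
    by (simp add: fps_sum_nth fps_X_div_one_minus_power)
  finally show "fps_nth ?F N = 0" by simp
qed

section \<open>Summing increments, and the ratio of consecutive terms\<close>

text \<open>The increment at n + i is at most \<rho> ^ i * \<bar>b n\<bar> * h n, as
  \<open>b\<close> decays geometrically and \<open>h\<close> decreases. The increments from n on add
  up to V n because V tends to 0.\<close>

lemma telescoping_tail_bound:
  fixes V b h :: "nat \<Rightarrow> real"
  assumes lim: "V \<longlonglongrightarrow> 0" and \<rho>: "0 \<le> \<rho>" "\<rho> < 1"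
    and step: "\<And>n. n \<ge> N \<Longrightarrow> \<bar>V n - V (Suc n)\<bar> \<le> \<bar>b n\<bar> * h n"
    and b: "\<And>n. n \<ge> N \<Longrightarrow> \<bar>b (Suc n)\<bar> \<le> \<rho> * \<bar>b n\<bar>"
    and h: "\<And>n. n \<ge> N \<Longrightarrow> 0 \<le> h (Suc n) \<and> h (Suc n) \<le> h n"
    and n: "n \<ge> N"
  shows "\<bar>V n\<bar> \<le> \<bar>b n\<bar> * h n / (1 - \<rho>)"
proof -
  have h0: "0 \<le> h n" using h[OF n] by linarith
  have bm: "\<bar>b (n + m)\<bar> \<le> \<rho> ^ m * \<bar>b n\<bar>" for m
  proof (induction m)
    case (Suc m)
    have "\<bar>b (n + Suc m)\<bar> \<le> \<rho> * \<bar>b (n + m)\<bar>" using b[of "n + m"] n by simp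
    also have "\<dots> \<le> \<rho> * (\<rho> ^ m * \<bar>b n\<bar>)" using Suc \<rho> by (intro mult_left_mono) auto
    finally show ?case by simp
  qed simp
  have hm: "0 \<le> h (n + m) \<and> h (n + m) \<le> h n" for m
  proof (induction m)
    case (Suc m)
    then show ?case using h[of "n + m"] n by auto
  qed (use h0 in simp)
  have partial: "\<bar>V n - V (n + m)\<bar> \<le> \<bar>b n\<bar> * h n * (\<Sum>i<m. \<rho> ^ i)" for m
  proof (induction m)
    case (Suc m)
    have "\<bar>V (n + m) - V (Suc (n + m))\<bar> \<le> \<bar>b (n + m)\<bar> * h (n + m)"
      using step n by simp
    also have "\<dots> \<le> (\<rho> ^ m * \<bar>b n\<bar>) * h n"
      using bm[of m] hm[of m] \<rho> by (intro mult_mono) auto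
    finally show ?case using Suc by (simp add: algebra_simps)
  qed simp
  have "(\<lambda>m. \<bar>V n - V (n + m)\<bar>) \<longlonglongrightarrow> \<bar>V n - 0\<bar>"
    using LIMSEQ_ignore_initial_segment[OF lim, of n]
    by (intro tendsto_intros) (simp add: add.commute)
  moreover have "(\<lambda>m. \<bar>b n\<bar> * h n * (\<Sum>i<m. \<rho> ^ i)) \<longlonglongrightarrow> \<bar>b n\<bar> * h n * (1 / (1 - \<rho>))"
    using geometric_sums[of \<rho>] \<rho> by (intro tendsto_intros) (simp add: sums_def)
  ultimately have "\<bar>V n - 0\<bar> \<le> \<bar>b n\<bar> * h n * (1 / (1 - \<rho>))"
    using partial by (intro LIMSEQ_le) auto
  then show ?thesis by simp
qed

text \<open>Uses (q + n) * (1 - q + n) = n * (n + 1) + q * (1 - q), together with y / (1 - y) = 1 /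
  n for y = 1 / (n + 1).\<close>

lemma hyp_coeff_Suc_scaled:
  fixes q t :: real
  assumes "n \<ge> 1"
  shows "hyp_coeff q (Suc n) * real (Suc n) * t ^ Suc n =
    ratio_fun q t (1 / real (Suc n)) * (hyp_coeff q n * real n * t ^ n)"
proof -
  \<comment> \<open>Here \<open>x\<close> is n itself; the argument of \<open>ratio_fun\<close> is 1
    / (1 + x).\<close>
  define x where "x = real n"
  have x: "x > 0" using assms by (simp add: x_def)
  have i: "inverse (1 - 1 / (1 + x)) = (1 + x) / x" using x by (simp add: field_simps)
  have "hyp_coeff q (Suc n) = hyp_coeff q n * ((1/2 + x) * (q + x) * (1 - q + x) / (1 + x) ^ 3)"
    by (simp add: hyp_coeff_def pochhammer_Suc x_def power_mult_distrib add_ac mult_ac)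
  then have "hyp_coeff q (Suc n) * real (Suc n) * t ^ Suc n =
      ((1/2 + x) * (q + x) * (1 - q + x) / (1 + x) ^ 3 * (1 + x) * t) * (hyp_coeff q n * t ^ n)"
    by (simp add: x_def mult_ac)
  also have "(1/2 + x) * (q + x) * (1 - q + x) / (1 + x) ^ 3 * (1 + x) * t
      = ratio_fun q t (1 / (1 + x)) * x"
    unfolding ratio_fun_def i using x
    by (simp add: divide_simps) (simp add: algebra_simps power3_eq_cube power2_eq_square)
  finally show ?thesis by (simp add: x_def mult_ac)
qed

section \<open>The asymptotic expansion of the remainder\<close>

theorem theorem1:
  fixes p q r s t :: real
  assumes "algebraic p" "algebraic q" "algebraic r" "algebraic s" "algebraic t"
    and "0 < q" "q < 1" "\<bar>t\<bar> < 1"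
    and "series_term q r s t sums (p / pi)"
  shows "\<forall>J\<ge>1. \<exists>E :: nat \<Rightarrow> real. E \<in> O(\<lambda>n. 1 / real n ^ J) \<and>
    (\<forall>\<^sub>F n in sequentially.
       remainder p q r s t n =
         hyp_coeff q n * real n * t ^ n *
           ((\<Sum>j<J. c_coeff q r s t j / real n ^ j) + E n))"
proof (intro allI impI)
  fix J :: nat assume "J \<ge> 1"
  define c where "c = c_coeff q r s t"
  define b where "b n = hyp_coeff q n * real n * t ^ n" for n
  define T where "T n = (\<Sum>j<J. c j / real n ^ j)" for n
  define V where "V n = remainder p q r s t n - b n * T n" for n
  define f where "f x = ratio_fun q t x * (s + r * x + (\<Sum>j<J. c j * x ^ j))
             - (\<Sum>j<J. c j * (x * inverse (1 - x)) ^ j)" for x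
  have x0: "filterlim (\<lambda>n. 1 / real (Suc n)) (at 0) sequentially"
    unfolding filterlim_at by (intro conjI LIMSEQ_Suc[OF lim_1_over_n]) simp
  have b_Suc: "b (Suc n) = ratio_fun q t (1 / real (Suc n)) * b n" if "n \<ge> 1" for n
    unfolding b_def by (rule hyp_coeff_Suc_scaled[OF that])

  have "f \<in> O[at 0](\<lambda>x. x ^ J)"
    unfolding f_def c_def by (rule defect_bigo) (use assms(8) in auto)
  from landau_o.big.compose[OF this x0]
  obtain K where K: "K > 0" "eventually (\<lambda>n. \<bar>f (1 / real (Suc n))\<bar> \<le> K * (1 / real (Suc n)) ^ J) sequentially"
    by (elim landau_o.bigE) (auto simp: power_divide)

  \<comment> \<open>The midpoint of \<bar>t\<bar> and 1: the ratios tend to \<bar>t\<bar> in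
    absolute value, so they are eventually below \<rho>, which is still less than 1.\<close>
  define \<rho> where "\<rho> = (1 + \<bar>t\<bar>) / 2"
  have \<rho>: "0 \<le> \<rho>" "\<rho> < 1" "\<bar>t\<bar> < \<rho>" using assms(8) by (auto simp: \<rho>_def)
  have "((\<lambda>x. \<bar>ratio_fun q t x\<bar>) \<longlongrightarrow> \<bar>t * (1 - 1/2 * 0) * (1 + q * (1 - q) * 0 * (0 * inverse (1 - 0)))\<bar>) (at 0)"
    unfolding ratio_fun_def by (intro tendsto_intros) auto
  then have "(\<lambda>n. \<bar>ratio_fun q t (1 / real (Suc n))\<bar>) \<longlonglongrightarrow> \<bar>t\<bar>"
    using filterlim_compose[OF _ x0] by fastforce
  then have "eventually (\<lambda>n. \<bar>ratio_fun q t (1 / real (Suc n))\<bar> < \<rho>) sequentially"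
    by (rule order_tendstoD) (use \<rho> in simp)
  with K(2) eventually_ge_at_top[of 1]
  have "eventually (\<lambda>n. \<bar>f (1 / real (Suc n))\<bar> \<le> K * (1 / real (Suc n)) ^ J
      \<and> \<bar>ratio_fun q t (1 / real (Suc n))\<bar> < \<rho> \<and> n \<ge> 1) sequentially"
    by eventually_elim simp
  then obtain N where N: "\<And>n. n \<ge> N \<Longrightarrow> \<bar>f (1 / real (Suc n))\<bar> \<le> K * (1 / real (Suc n)) ^ J
      \<and> \<bar>ratio_fun q t (1 / real (Suc n))\<bar> < \<rho> \<and> n \<ge> 1"
    by (auto simp: eventually_sequentially)
  have b_le: "\<bar>b (Suc n)\<bar> \<le> \<rho> * \<bar>b n\<bar>" if "n \<ge> N" for n
    using N[OF that] b_Suc[of n] by (auto simp: abs_mult intro!: mult_right_mono)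

  \<comment> \<open>The limit is left unevaluated to match \<open>tendsto_intros\<close>; T only
    needs some finite limit, since b tends to 0.\<close>
  have "V \<longlonglongrightarrow> 0 - 0 * (\<Sum>j<J. c j * 0 ^ j)"
    unfolding V_def
  proof (intro tendsto_intros)
    have "(\<lambda>n. p / pi - (\<Sum>k\<le>n. series_term q r s t k)) \<longlonglongrightarrow> p / pi - p / pi"
      using assms(9) by (intro tendsto_intros) (simp add: sums_def_le)
    then show "remainder p q r s t \<longlonglongrightarrow> 0"
      by (simp add: remainder_def[abs_def])
    show "b \<longlonglongrightarrow> 0"
      using summable_ratio_test[of \<rho> N b] \<rho> b_le by (intro summable_LIMSEQ_zero) auto
    have "(\<lambda>n. \<Sum>j<J. c j * (1 / real n) ^ j) \<longlonglongrightarrow> (\<Sum>j<J. c j * 0 ^ j)"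
      by (intro tendsto_intros lim_1_over_n)
    then show "T \<longlonglongrightarrow> (\<Sum>j<J. c j * 0 ^ j)"
      by (simp add: T_def[abs_def] power_divide)
  qed
  then have V0: "V \<longlonglongrightarrow> 0" by simp

  \<comment> \<open>The remainder drops by the next series term, which is b (n + 1) * (s + r * x)
    since r + s * (n + 1) = (n + 1) * (s + r * x). Writing b (n + 1) as D x * b n then leaves
    exactly the defect \<open>f\<close>.\<close>
  have V_step: "V n - V (Suc n) = b n * f (1 / real (Suc n))" if n: "n \<ge> 1" for n
  proof -
    define x where "x = 1 / real (Suc n)"
    have y: "x * inverse (1 - x) = 1 / real n"
      using n by (simp add: x_def field_simps)
    have T1: "T (Suc n) = (\<Sum>j<J. c j * x ^ j)" and T0: "T n = (\<Sum>j<J. c j * (x * inverse (1 - x)) ^ j)"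
      unfolding T_def y by (simp_all add: x_def power_divide)
    have "remainder p q r s t n - remainder p q r s t (Suc n) = series_term q r s t (Suc n)"
      by (simp add: remainder_def)
    also have "\<dots> = b (Suc n) * (s + r * x)"
      by (simp add: series_term_def b_def x_def field_simps)
    finally have "V n - V (Suc n) = b (Suc n) * (s + r * x + T (Suc n)) - b n * T n"
      by (simp add: V_def algebra_simps)
    then show ?thesis
      unfolding b_Suc[OF n] T1 T0 f_def x_def[symmetric] by (simp add: algebra_simps)
  qed

  have V_bound: "\<bar>V n\<bar> \<le> \<bar>b n\<bar> * (K * (1 / real (Suc n)) ^ J) / (1 - \<rho>)" if "n \<ge> N" for n
  proof (rule telescoping_tail_bound[where N = N and b = b and h = "\<lambda>n. K * (1 / real (Suc n)) ^ J",
        OF V0 \<rho>(1,2) _ b_le _ that])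
    fix n assume n: "n \<ge> N"
    show "\<bar>V n - V (Suc n)\<bar> \<le> \<bar>b n\<bar> * (K * (1 / real (Suc n)) ^ J)"
      using N[OF n] V_step[of n] by (auto simp: abs_mult intro!: mult_left_mono)
    have "1 / real (Suc (Suc n)) \<le> 1 / real (Suc n)" by (simp add: field_simps)
    then show "0 \<le> K * (1 / real (Suc (Suc n))) ^ J \<and>
        K * (1 / real (Suc (Suc n))) ^ J \<le> K * (1 / real (Suc n)) ^ J"
      using K(1) by (intro conjI mult_left_mono power_mono) auto
  qed

  \<comment> \<open>If \<open>b n = 0\<close> (which happens for \<open>t = 0\<close>), then \<open>V n = 0\<close> by \<open>V_bound\<close>, so the junk value
    \<open>E n = 0\<close> is the right one.\<close>
  define E where "E n = V n / b n" for n
  have "E \<in> O(\<lambda>n. 1 / real n ^ J)"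
  proof (rule bigoI)
    show "eventually (\<lambda>n. norm (E n) \<le> K / (1 - \<rho>) * norm (1 / real n ^ J)) sequentially"
      using eventually_ge_at_top[of N]
    proof eventually_elim
      case (elim n)
      have n1: "n \<ge> 1" using N[OF elim] by simp
      have "\<bar>E n\<bar> \<le> K * (1 / real (Suc n)) ^ J / (1 - \<rho>)"
        using V_bound[OF elim] K(1) \<rho>
        by (cases "b n = 0") (auto simp: E_def field_simps)
      also have "\<dots> \<le> K * (1 / real n) ^ J / (1 - \<rho>)"
        using K(1) \<rho> n1 by (intro divide_right_mono mult_left_mono power_mono) (auto simp: field_simps)
      finally show ?case using n1 by (simp add: power_divide mult.commute)
    qed
  qed
  moreover have "\<forall>\<^sub>F n in sequentially. remainder p q r s t n =
         hyp_coeff q n * real n * t ^ n * ((\<Sum>j<J. c_coeff q r s t j / real n ^ j) + E n)"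
    using eventually_ge_at_top[of N]
  proof eventually_elim
    case (elim n)
    have "b n * E n = V n"
      using V_bound[OF elim] by (cases "b n = 0") (auto simp: E_def)
    then have "remainder p q r s t n = b n * (T n + E n)"
      by (simp add: V_def algebra_simps)
    then show ?case by (simp add: b_def T_def c_def)
  qed
  ultimately show "\<exists>E. E \<in> O(\<lambda>n. 1 / real n ^ J) \<and>
    (\<forall>\<^sub>F n in sequentially. remainder p q r s t n =
         hyp_coeff q n * real n * t ^ n * ((\<Sum>j<J. c_coeff q r s t j / real n ^ j) + E n))"
    by blast
qed

end
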